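(* Let $\mathscr{A}$ be a unital $^*$-algebra, $\mathscr{I}\subseteq\mathscr{A}$ a left ideal and $f\in\mathscr{A}^*$ a representable positive functional. If $g_0:\mathscr{I}\to\mathbb{C}$ is an $f$-bounded symmetric linear functional with $f$-bound $\alpha_f(g_0)$, then there exist two (distinguished) $f$-bounded hermitian functionals $g_m,g_M\in\mathscr{A}^*$ extending $g_0$ with $f$-bound $\alpha_f(g_m)=\alpha_f(g_M)=\alpha_f(g_0)$. Furthermore, $g_m\le g_M$ and the interval $[g_m,g_M]$ consists of all hermitian $f$-bound preserving extensions of $g_0$: $$[g_m,g_M]=\{g\in\mathscr{A}^*\;:\;g_0\subset g=g^*,\ \alpha_f(g)=\alpha_f(g_0)\}.$$
   Context: $\mathscr{A}$ is a complex $^*$-algebra with unit $1$ (no topology is assumed) and $\mathscr{A}^*$ denotes its algebraic dual. A linear functional $f\in\mathscr{A}^*$ is positive if $f(x^*x)\ge0$ for all $x\in\mathscr{A}$. A positive functional $f$ is called representable if for every $x\in\mathscr{A}$ there is a constant $M_x\ge0$ such that $$|f(y^*x^*xy)|\le M_x f(y^*y),\qquad y\in\mathscr{A}.$$ A linear functional $g:\mathscr{I}\to\mathbb{C}$ on a left ideal $\mathscr{I}$ is symmetric if $g(b^*a)=\overline{g(a^*b)}$ for all $a,b\in\mathscr{I}$. A linear functional $g\in\mathscr{A}^*$ is hermitian (written $g=g^*$) if $g(x^* )=\overline{g(x)}$ for all $x\in\mathscr{A}$. A symmetric functional $g:\mathscr{I}\to\mathbb{C}$ is called $f$-bounded if there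 is a constant $\alpha$ such that $$|g(x^*a)|^2\le\alpha^2 f(x^*x)f(a^*a),\qquad x\in\mathscr{A},\ a\in\mathscr{I};$$ the smallest such constant $\alpha\ge 0$ is the $f$-bound of $g$, denoted $\alpha_f(g)$. For functionals in $\mathscr{A}^*$ this definition is used with $\mathscr{I}=\mathscr{A}$; the condition $\alpha_f(g)=\alpha_f(g_0)$ includes that $g$ is $f$-bounded. For hermitian $g,h\in\mathscr{A}^*$, $g\le h$ means that $h-g$ is positive, and $[g_m,g_M]$ is the set of hermitian $g\in\mathscr{A}^*$ with $g_m\le g\le g_M$. $g_0\subset g$ means that $g$ extends $g_0$. *)

theory Defs
  imports "HOL-Analysis.Analysis" "HOL-Library.Complex_Order"
begin

text \<open>
  Unital complex *-algebras without topology. The class \<open>ring\<close> together with \<open>monoid_mult\<close>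
  is used instead of \<open>ring_1\<close>, so that the zero algebra (where \<open>0 = 1\<close>) is not excluded.
\<close>

class complex_star_algebra = ring + monoid_mult +
  fixes scaleC :: "complex \<Rightarrow> 'a \<Rightarrow> 'a"  (infixr "*\<^sub>C" 75)
    and star :: "'a \<Rightarrow> 'a"  ("_\<^sup>\<star>" [1000] 999)
  assumes scaleC_add_right: "c *\<^sub>C (x + y) = c *\<^sub>C x + c *\<^sub>C y"
    and scaleC_add_left: "(c + d) *\<^sub>C x = c *\<^sub>C x + d *\<^sub>C x"
    and scaleC_scaleC: "c *\<^sub>C (d *\<^sub>C x) = (c * d) *\<^sub>C x"
    and scaleC_one: "1 *\<^sub>C x = x"
    and mult_scaleC_left: "(c *\<^sub>C x) * y = c *\<^sub>C (x * y)"
    and mult_scaleC_right: "x * (c *\<^sub>C y) = c *\<^sub>C (x * y)"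
    and star_star: "(x\<^sup>\<star>)\<^sup>\<star> = x"
    and star_add: "(x + y)\<^sup>\<star> = x\<^sup>\<star> + y\<^sup>\<star>"
    and star_scaleC: "(c *\<^sub>C x)\<^sup>\<star> = cnj c *\<^sub>C x\<^sup>\<star>"
    and star_mult: "(x * y)\<^sup>\<star> = y\<^sup>\<star> * x\<^sup>\<star>"

interpretation cvs: vector_space "scaleC :: complex \<Rightarrow> 'a::complex_star_algebra \<Rightarrow> 'a"
  by unfold_locales
    (simp_all add: scaleC_add_right scaleC_add_left scaleC_scaleC scaleC_one)

definition left_ideal :: "'a::complex_star_algebra set \<Rightarrow> bool" where
  "left_ideal I \<longleftrightarrow> cvs.subspace I \<and> (\<forall>x. \<forall>a\<in>I. x * a \<in> I)"

text \<open>The algebraic dual.\<close>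

definition dual :: "('a::complex_star_algebra \<Rightarrow> complex) set" where
  "dual = {f. Vector_Spaces.linear (*\<^sub>C) (*) f}"

text \<open>
  A functional on a left ideal \<open>I\<close> is represented by a total function whose values outside \<open>I\<close>
  are irrelevant: all notions below with an argument \<open>I\<close> only inspect values on \<open>I\<close>
  (as \<open>x\<^sup>\<star> * a \<in> I\<close> whenever \<open>a \<in> I\<close>).
\<close>

definition linear_functional_on ::
    "'a::complex_star_algebra set \<Rightarrow> ('a \<Rightarrow> complex) \<Rightarrow> bool" where
  "linear_functional_on I g \<longleftrightarrow>
     (\<forall>a\<in>I. \<forall>b\<in>I. g (a + b) = g a + g b) \<and> (\<forall>c. \<forall>a\<in>I. g (c *\<^sub>C a) = c * g a)"

lemma linear_functional_on_UNIV: "linear_functional_on UNIV f \<longleftrightarrow> f \<in> dual"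
proof -
  have vs: "vector_space ((*) :: complex \<Rightarrow> complex \<Rightarrow> complex)"
    by unfold_locales (simp_all add: algebra_simps)
  show ?thesis
    unfolding dual_def linear_functional_on_def linear_iff_module_hom module_hom_iff
    using vs cvs.module_axioms by (auto simp: module_iff_vector_space)
qed

definition symmetric_on ::
    "'a::complex_star_algebra set \<Rightarrow> ('a \<Rightarrow> complex) \<Rightarrow> bool" where
  "symmetric_on I g \<longleftrightarrow> (\<forall>a\<in>I. \<forall>b\<in>I. g (b\<^sup>\<star> * a) = cnj (g (a\<^sup>\<star> * b)))"

definition hermitian :: "('a::complex_star_algebra \<Rightarrow> complex) \<Rightarrow> bool" where
  "hermitian g \<longleftrightarrow> (\<forall>x. g (x\<^sup>\<star>) = cnj (g x))"

text \<open>
  In the order of \<open>Complex_Order\<close>, \<open>0 \<le> z\<close> means that \<open>z\<close> is real and nonnegative. Values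
  \<open>f (x\<^sup>\<star> * x)\<close> of a positive functional are thus real, and \<open>Re\<close> below is only a coercion.
\<close>

definition positive_functional :: "('a::complex_star_algebra \<Rightarrow> complex) \<Rightarrow> bool" where
  "positive_functional f \<longleftrightarrow> f \<in> dual \<and> (\<forall>x. 0 \<le> f (x\<^sup>\<star> * x))"

definition representable :: "('a::complex_star_algebra \<Rightarrow> complex) \<Rightarrow> bool" where
  "representable f \<longleftrightarrow> positive_functional f \<and>
     (\<forall>x. \<exists>M\<ge>0. \<forall>y. cmod (f (y\<^sup>\<star> * x\<^sup>\<star> * x * y)) \<le> M * Re (f (y\<^sup>\<star> * y)))"

definition bounding_constant ::
    "('a::complex_star_algebra \<Rightarrow> complex) \<Rightarrow> 'a set \<Rightarrow> ('a \<Rightarrow> complex) \<Rightarrow> real \<Rightarrow> bool" where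
  "bounding_constant f I g \<alpha> \<longleftrightarrow>
     (\<forall>x. \<forall>a\<in>I. (cmod (g (x\<^sup>\<star> * a)))\<^sup>2 \<le> \<alpha>\<^sup>2 * Re (f (x\<^sup>\<star> * x)) * Re (f (a\<^sup>\<star> * a)))"

definition f_bounded ::
    "('a::complex_star_algebra \<Rightarrow> complex) \<Rightarrow> 'a set \<Rightarrow> ('a \<Rightarrow> complex) \<Rightarrow> bool" where
  "f_bounded f I g \<longleftrightarrow> (\<exists>\<alpha>. bounding_constant f I g \<alpha>)"

definition f_bound ::
    "('a::complex_star_algebra \<Rightarrow> complex) \<Rightarrow> 'a set \<Rightarrow> ('a \<Rightarrow> complex) \<Rightarrow> real" where
  "f_bound f I g = (LEAST \<alpha>. 0 \<le> \<alpha> \<and> bounding_constant f I g \<alpha>)"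

text \<open>The smallest nonnegative constant is attained, so \<open>f_bound\<close> is meaningful.\<close>

lemma f_bound_least:
  assumes "f_bounded f I g"
  shows "0 \<le> f_bound f I g" "bounding_constant f I g (f_bound f I g)"
    "\<And>\<alpha>. 0 \<le> \<alpha> \<Longrightarrow> bounding_constant f I g \<alpha> \<Longrightarrow> f_bound f I g \<le> \<alpha>"
proof -
  define S where "S = {\<alpha>. 0 \<le> \<alpha> \<and> bounding_constant f I g \<alpha>}"
  obtain \<alpha> where "bounding_constant f I g \<alpha>"
    using assms by (auto simp: f_bounded_def)
  then have ne: "S \<noteq> {}"
    by (auto simp: S_def bounding_constant_def intro!: exI[of _ "\<bar>\<alpha>\<bar>"])
  have bdd: "bdd_below S"
    by (auto simp: S_def intro!: bdd_belowI[of _ 0])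
  have "closed S"
    unfolding S_def bounding_constant_def Ball_def
    by (intro closed_Collect_conj closed_Collect_all closed_Collect_imp closed_Collect_le
        continuous_intros) auto
  then have mem: "Inf S \<in> S"
    using ne bdd by (simp add: closed_contains_Inf)
  then have "f_bound f I g = Inf S"
    unfolding f_bound_def
    by (intro Least_equality) (use bdd in \<open>auto simp: S_def intro: cInf_lower\<close>)
  then show "0 \<le> f_bound f I g" "bounding_constant f I g (f_bound f I g)"
    "\<And>\<alpha>. 0 \<le> \<alpha> \<Longrightarrow> bounding_constant f I g \<alpha> \<Longrightarrow> f_bound f I g \<le> \<alpha>"
    using mem bdd by (auto simp: S_def intro: cInf_lower)
qed

definition extends ::
    "'a::complex_star_algebra set \<Rightarrow> ('a \<Rightarrow> complex) \<Rightarrow> ('a \<Rightarrow> complex) \<Rightarrow> bool" where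
  "extends I g0 g \<longleftrightarrow> (\<forall>a\<in>I. g a = g0 a)"

definition functional_le ::
    "('a::complex_star_algebra \<Rightarrow> complex) \<Rightarrow> ('a \<Rightarrow> complex) \<Rightarrow> bool"  (infix "\<preceq>" 50) where
  "g \<preceq> h \<longleftrightarrow> positive_functional (\<lambda>x. h x - g x)"

definition functional_interval ::
    "('a::complex_star_algebra \<Rightarrow> complex) \<Rightarrow> ('a \<Rightarrow> complex) \<Rightarrow> ('a \<Rightarrow> complex) set" where
  "functional_interval gm gM = {g \<in> dual. hermitian g \<and> gm \<preceq> g \<and> g \<preceq> gM}"

end

theory Submission
  imports Defs
begin

text \<open>
  This is Krein's description of the norm preserving self-adjoint extensions of a bounded symmetric
  operator, carried out for functionals. Let \<open>\<alpha>\<close> be the \<open>f\<close>-bound of \<open>g\<^sub>0\<close>. A hermitian \<open>g\<close> has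
  \<open>\<alpha>\<close> as a bounding constant iff both \<open>\<alpha> f + g\<close> and \<open>\<alpha> f - g\<close> are positive, and an extension of
  \<open>g\<^sub>0\<close> cannot have a smaller bound than \<open>g\<^sub>0\<close>. So the bound preserving extensions of \<open>g\<^sub>0\<close>
  are those hermitian extensions \<open>g\<close> for which \<open>\<alpha> f \<plusminus> g\<close> are positive extensions of the functionals
  \<open>\<alpha> f \<plusminus> g\<^sub>0\<close> on \<open>I\<close> (lemma \<open>bound_preserving_iff\<close>).

  Each of \<open>h = \<alpha> f + g\<^sub>0\<close> and \<open>h = \<alpha> f - g\<^sub>0\<close> satisfies
  \<open>|h (x\<^sup>\<star> a)|\<^sup>2 \<le> 2 \<alpha> f (x\<^sup>\<star> x) h (a\<^sup>\<star> a)\<close> for \<open>a \<in> I\<close> and every \<open>x\<close>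
  (lemma \<open>bounding_constant_imp_dominated\<close>), and such an \<open>h\<close> has a smallest positive extension, which
  moreover lies below \<open>2 \<alpha> f\<close> (lemma \<open>minimal_positive_extension\<close>). If \<open>p\<close> and \<open>n\<close> are the two
  smallest extensions, then \<open>p - \<alpha> f\<close> and \<open>\<alpha> f - n\<close> are the smallest and the largest bound
  preserving extension of \<open>g\<^sub>0\<close>. Conversely, a functional between these two extensions
  of \<open>g\<^sub>0\<close> extends \<open>g\<^sub>0\<close> by the Cauchy-Schwarz inequality, and lies between \<open>- \<alpha> f\<close> and \<open>\<alpha> f\<close>.

  The smallest extension is usually built by completing \<open>I\<close> under \<open>h (b\<^sup>\<star> a)\<close> and the algebra under
  \<open>f (y\<^sup>\<star> x)\<close> to Hilbert spaces \<open>H\<^sub>h\<close> and \<open>H\<^sub>f\<close>: the bounded operator \<open>J\<close> from \<open>H\<^sub>h\<close> to \<open>H\<^sub>f\<close> with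
  \<open>\<langle>J a, x\<rangle> = h (x\<^sup>\<star> a)\<close> yields the functional \<open>x \<mapsto> \<langle>J J\<^sup>* x, 1\<rangle>\<close>. Here both completions are avoided
  by working with the seminorm \<open>\<parallel>J\<^sup>* x\<parallel>\<close> on the algebra. It is the norm of the functional
  \<open>a \<mapsto> h (x\<^sup>\<star> a)\<close> on \<open>I\<close>, and in it \<open>I\<close> is dense, left multiplications are bounded and \<open>h\<close> is
  continuous. The smallest extension is the extension of \<open>h\<close> by continuity.
\<close>

section \<open>Positive functionals on a left ideal\<close>

lemma star_zero [simp]: "(0::'a::complex_star_algebra)\<^sup>\<star> = 0"
  using star_add[of "0::'a" 0] by simp

lemma star_minus [simp]: "(- x)\<^sup>\<star> = - (x\<^sup>\<star>)" for x :: "'a::complex_star_algebra"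
  using star_add[of x "- x"] by (simp add: eq_neg_iff_add_eq_0 add.commute)

lemma star_diff: "(x - y)\<^sup>\<star> = x\<^sup>\<star> - y\<^sup>\<star>" for x y :: "'a::complex_star_algebra"
  using star_add[of x "- y"] by simp

lemma star_one [simp]: "(1::'a::complex_star_algebra)\<^sup>\<star> = 1"
  by (metis mult_1 mult_1_right star_mult star_star)

lemma star_power: "(x ^ n)\<^sup>\<star> = (x\<^sup>\<star>) ^ n" for x :: "'a::complex_star_algebra"
  by (induction n) (simp_all add: star_mult power_commutes)

lemma left_idealD:
  assumes "left_ideal I"
  shows "0 \<in> I" "a \<in> I \<Longrightarrow> b \<in> I \<Longrightarrow> a + b \<in> I" "a \<in> I \<Longrightarrow> b \<in> I \<Longrightarrow> a - b \<in> I"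
    "a \<in> I \<Longrightarrow> c *\<^sub>C a \<in> I" "a \<in> I \<Longrightarrow> x * a \<in> I"
  using assms
  by (auto simp: left_ideal_def cvs.subspace_0 cvs.subspace_add cvs.subspace_diff
      cvs.subspace_scale)

lemma left_ideal_UNIV: "left_ideal UNIV"
  by (simp add: left_ideal_def cvs.subspace_UNIV)

lemma linear_functional_onD:
  assumes "left_ideal I" "linear_functional_on I g"
  shows "a \<in> I \<Longrightarrow> b \<in> I \<Longrightarrow> g (a + b) = g a + g b"
    "a \<in> I \<Longrightarrow> g (c *\<^sub>C a) = c * g a"
    "a \<in> I \<Longrightarrow> b \<in> I \<Longrightarrow> g (a - b) = g a - g b"
    "g 0 = 0"
proof -
  show add: "g (a + b) = g a + g b" if "a \<in> I" "b \<in> I" for a b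
    using assms that by (simp add: linear_functional_on_def)
  show sc: "g (c *\<^sub>C a) = c * g a" if "a \<in> I" for a c
    using assms that by (simp add: linear_functional_on_def)
  show "g (a - b) = g a - g b" if "a \<in> I" "b \<in> I" for a b
    using add[of "a - b" b] that left_idealD[OF assms(1)] by simp
  show "g 0 = 0"
    using sc[of 0 0] left_idealD[OF assms(1)] by simp
qed

definition positive_on :: "'a::complex_star_algebra set \<Rightarrow> ('a \<Rightarrow> complex) \<Rightarrow> bool" where
  "positive_on I h \<longleftrightarrow> linear_functional_on I h \<and> (\<forall>a\<in>I. 0 \<le> h (a\<^sup>\<star> * a))"

lemma positive_on_UNIV: "positive_on UNIV f \<longleftrightarrow> positive_functional f"
  by (simp add: positive_on_def positive_functional_def linear_functional_on_UNIV)

lemma linear_on_square_add: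
  fixes t :: complex
  assumes "left_ideal I" "linear_functional_on I h" "a \<in> I" "b \<in> I"
  shows "h ((a + t *\<^sub>C b)\<^sup>\<star> * (a + t *\<^sub>C b)) =
    h (a\<^sup>\<star> * a) + t * h (a\<^sup>\<star> * b) + cnj t * h (b\<^sup>\<star> * a) + cnj t * t * h (b\<^sup>\<star> * b)"
  using assms
  by (simp add: star_add star_scaleC distrib_left distrib_right mult_scaleC_left
      mult_scaleC_right scaleC_scaleC linear_functional_onD[OF assms(1,2)]
      left_idealD[OF assms(1)] scaleC_add_right algebra_simps)

text \<open>
  Polarization: the diagonal values at \<open>a + t b\<close> are real for \<open>t = 1\<close> and \<open>t = \<i>\<close>, which relates
  the two off-diagonal values.
\<close>

lemma positive_on_symmetric:
  assumes "left_ideal I" "positive_on I h"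
  shows "symmetric_on I h"
  unfolding symmetric_on_def
proof (intro ballI)
  fix a b assume ab: "a \<in> I" "b \<in> I"
  have lin: "linear_functional_on I h"
    using assms by (simp add: positive_on_def)
  have real: "Im (h (x\<^sup>\<star> * x)) = 0" if "x \<in> I" for x
    using assms that by (auto simp: positive_on_def less_eq_complex_def)
  have "Im (t * h (a\<^sup>\<star> * b) + cnj t * h (b\<^sup>\<star> * a)) = 0" for t
    using real[of "a + t *\<^sub>C b"] real[of a] real[of b] ab left_idealD[OF assms(1)]
    by (simp add: linear_on_square_add[OF assms(1) lin ab])
  from this[of 1] this[of \<i>] show "h (b\<^sup>\<star> * a) = cnj (h (a\<^sup>\<star> * b))"
    by (simp add: complex_eq_iff)
qed

text \<open>
  The discriminant argument behind the Cauchy-Schwarz inequality. It is isolated because it also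
  turns the near-maximality in \<open>ideal_dense\<close> and the domination in
  \<open>bounding_constant_imp_dominated\<close> into inequalities between squared moduli: the left-hand side
  of the hypothesis is largest at \<open>t = cnj z / c\<close>, with value \<open>|z|\<^sup>2 / c\<close>, and for \<open>c = 0\<close> it is unbounded unless
  \<open>z = 0\<close>.
\<close>

lemma cmod_square_le_of_quadratic_bound:
  fixes z :: complex and c B :: real
  assumes bound: "\<And>t. 2 * Re (t * z) - (cmod t)\<^sup>2 * c \<le> B" and "0 \<le> c"
  shows "(cmod z)\<^sup>2 \<le> c * B"
proof -
  have *: "2 * s * (cmod z)\<^sup>2 - s\<^sup>2 * (cmod z)\<^sup>2 * c \<le> B" for s :: real
  proof -
    have "Re (complex_of_real s * cnj z * z) = s * (cmod z)\<^sup>2"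
      by (subst cmod_power2) (simp add: power2_eq_square algebra_simps)
    then show ?thesis
      using bound[of "complex_of_real s * cnj z"]
      by (simp add: norm_mult power_mult_distrib)
  qed
  show ?thesis
  proof (cases "c = 0")
    case True
    have "z = 0"
    proof (rule ccontr)
      assume "z \<noteq> 0"
      then have "(cmod z)\<^sup>2 > 0" by simp
      then show False
        using *[of "(\<bar>B\<bar> + 1) / (cmod z)\<^sup>2"] True by simp
    qed
    then show ?thesis using True by simp
  next
    case False
    then have "c > 0" using assms by simp
    with *[of "1 / c"] have "(cmod z)\<^sup>2 / c \<le> B"
      by (simp add: power2_eq_square field_simps)
    with \<open>c > 0\<close> show ?thesis by (simp add: field_simps)
  qed
qed

lemma positive_on_Cauchy_Schwarz:
  assumes "left_ideal I" "positive_on I h" "a \<in> I" "b \<in> I"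
  shows "(cmod (h (b\<^sup>\<star> * a)))\<^sup>2 \<le> Re (h (b\<^sup>\<star> * b)) * Re (h (a\<^sup>\<star> * a))"
proof -
  have lin: "linear_functional_on I h"
    and pos: "\<And>x. x \<in> I \<Longrightarrow> 0 \<le> Re (h (x\<^sup>\<star> * x))"
    using assms by (auto simp: positive_on_def less_eq_complex_def)
  have sym: "h (b\<^sup>\<star> * a) = cnj (h (a\<^sup>\<star> * b))"
    using positive_on_symmetric[OF assms(1,2)] assms(3,4) unfolding symmetric_on_def by blast
  have "2 * Re (t * h (a\<^sup>\<star> * b)) - (cmod t)\<^sup>2 * Re (h (b\<^sup>\<star> * b)) \<le> Re (h (a\<^sup>\<star> * a))" for t
  proof -
    have "0 \<le> Re (h ((a + (- t) *\<^sub>C b)\<^sup>\<star> * (a + (- t) *\<^sub>C b)))"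
      using assms left_idealD[OF assms(1)] by (intro pos) blast
    also have "\<dots> = Re (h (a\<^sup>\<star> * a)) - 2 * Re (t * h (a\<^sup>\<star> * b))
        + Re (cnj t * t * h (b\<^sup>\<star> * b))"
      by (subst linear_on_square_add[OF assms(1) lin assms(3,4)]) (simp add: sym)
    also have "cnj t * t = complex_of_real ((cmod t)\<^sup>2)"
      by (subst complex_norm_square) (simp add: mult.commute)
    finally show ?thesis by simp
  qed
  from cmod_square_le_of_quadratic_bound[OF this pos[OF assms(4)]] show ?thesis
    by (simp add: sym)
qed

lemma positive_functional_Cauchy_Schwarz:
  assumes "positive_functional f"
  shows "(cmod (f (y\<^sup>\<star> * x)))\<^sup>2 \<le> Re (f (y\<^sup>\<star> * y)) * Re (f (x\<^sup>\<star> * x))"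
  using positive_on_Cauchy_Schwarz[OF left_ideal_UNIV, of f x y] assms
  by (simp add: positive_on_UNIV)

lemma positive_functional_hermitian:
  assumes "positive_functional f"
  shows "hermitian f"
  using positive_on_symmetric[OF left_ideal_UNIV, of f] assms
  unfolding hermitian_def symmetric_on_def positive_on_UNIV
  by (metis UNIV_I mult_1 mult_1_right star_one)

section \<open>The minimal positive extension\<close>

text \<open>
  The ratios of consecutive terms of a log-convex sequence increase. If the first ratio exceeded
  \<open>M\<close>, the sequence would outgrow every multiple of \<open>M ^ n\<close>.
\<close>

lemma log_convex_first_ratio_le:
  fixes u :: "nat \<Rightarrow> real"
  assumes nonneg: "\<And>n. 0 \<le> u n" and convex: "\<And>n. (u (Suc n))\<^sup>2 \<le> u n * u (Suc (Suc n))"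
    and growth: "\<And>n. u n \<le> K * M ^ n" and "0 \<le> M"
  shows "u 1 \<le> M * u 0"
proof (rule ccontr)
  assume "\<not> u 1 \<le> M * u 0"
  then have less: "M * u 0 < u 1" by simp
  then have "u 1 > 0"
    using nonneg[of 0] \<open>0 \<le> M\<close> mult_nonneg_nonneg[of M "u 0"] by linarith
  have "u 0 > 0"
  proof (rule ccontr)
    assume "\<not> u 0 > 0"
    then have "(u 1)\<^sup>2 \<le> 0" using convex[of 0] nonneg[of 0] by simp
    with \<open>u 1 > 0\<close> show False by simp
  qed
  define r where "r = u 1 / u 0"
  have r: "r > M" "r > 0"
    using less \<open>u 0 > 0\<close> \<open>u 1 > 0\<close> by (simp_all add: r_def field_simps)
  have step: "u n > 0 \<and> r * u n \<le> u (Suc n)" for n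
  proof (induction n)
    case 0
    then show ?case using \<open>u 0 > 0\<close> by (simp add: r_def)
  next
    case (Suc n)
    then have pos: "u (Suc n) > 0"
      using r by (meson less_le_trans mult_pos_pos)
    have "u n * (r * u (Suc n)) = (r * u n) * u (Suc n)" by simp
    also have "\<dots> \<le> u (Suc n) * u (Suc n)"
      using Suc pos by (intro mult_right_mono) auto
    also have "\<dots> \<le> u n * u (Suc (Suc n))"
      using convex[of n] by (simp add: power2_eq_square)
    finally show ?case using Suc pos by simp
  qed
  have lower: "u 0 * r ^ n \<le> u n" for n
  proof (induction n)
    case (Suc n)
    have "u 0 * r ^ Suc n = r * (u 0 * r ^ n)" by simp
    also have "\<dots> \<le> r * u n" using Suc r by (intro mult_left_mono) auto
    finally show ?case using step[of n] by linarith
  qed simp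
  have "(\<lambda>n. K * (M / r) ^ n) \<longlonglongrightarrow> K * 0"
    using r \<open>0 \<le> M\<close> by (intro tendsto_mult tendsto_const LIMSEQ_power_zero) auto
  moreover have "u 0 \<le> K * (M / r) ^ n" for n
    using order_trans[OF lower growth, of n] r by (simp add: power_divide field_simps)
  ultimately have "u 0 \<le> K * 0"
    by (intro LIMSEQ_le_const) auto
  with \<open>u 0 > 0\<close> show False by simp
qed

lemma le_of_square_le_mult:
  fixes s K :: real
  assumes "s\<^sup>2 \<le> K * s" "0 \<le> s" "0 \<le> K"
  shows "s \<le> K"
  using assms by (cases "s = 0") (auto simp: power2_eq_square)

text \<open>
  The inequality \<open>dominated\<close> says that \<open>a \<mapsto> h (x\<^sup>\<star> a)\<close> is bounded for the seminorm
  \<open>sqrt (h (a\<^sup>\<star> a))\<close> on \<open>I\<close>, uniformly in \<open>x\<close> with \<open>f (x\<^sup>\<star> x) \<le> 1\<close>. It is necessary for the existence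
  of a positive extension of \<open>h\<close> below \<open>C f\<close>, by the Cauchy-Schwarz inequality for the extension.
\<close>

locale dominated_positive_functional =
  fixes I :: "'a::complex_star_algebra set" and f h :: "'a \<Rightarrow> complex" and C :: real
  assumes ideal: "left_ideal I" and rep: "representable f" and pos: "positive_on I h"
    and C_nonneg: "0 \<le> C"
    and dominated: "\<And>x a. a \<in> I \<Longrightarrow>
      (cmod (h (x\<^sup>\<star> * a)))\<^sup>2 \<le> C * Re (f (x\<^sup>\<star> * x)) * Re (h (a\<^sup>\<star> * a))"
begin

lemmas ideal_rules = left_idealD[OF ideal]

lemma linear_on: "linear_functional_on I h"
  using pos by (simp add: positive_on_def)

lemmas linear_rules = linear_functional_onD[OF ideal linear_on]

lemma nonneg: "a \<in> I \<Longrightarrow> 0 \<le> Re (h (a\<^sup>\<star> * a))"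
  and square_real: "a \<in> I \<Longrightarrow> Im (h (a\<^sup>\<star> * a)) = 0"
  using pos by (auto simp: positive_on_def less_eq_complex_def complex_eq_iff)

lemma sym: "a \<in> I \<Longrightarrow> b \<in> I \<Longrightarrow> h (b\<^sup>\<star> * a) = cnj (h (a\<^sup>\<star> * b))"
  using positive_on_symmetric[OF ideal pos] unfolding symmetric_on_def by blast

lemma f_positive: "positive_functional f"
  using rep by (simp add: representable_def)

lemma f_nonneg: "0 \<le> Re (f (x\<^sup>\<star> * x))"
  using f_positive by (auto simp: positive_functional_def less_eq_complex_def)

definition hnorm :: "'a \<Rightarrow> real" where
  "hnorm a = sqrt (Re (h (a\<^sup>\<star> * a)))"

text \<open>
  The factor \<open>C\<close> is absorbed, so that the domination reads \<open>|h (x\<^sup>\<star> a)| \<le> fnorm x * hnorm a\<close>.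
\<close>

definition fnorm :: "'a \<Rightarrow> real" where
  "fnorm x = sqrt (C * Re (f (x\<^sup>\<star> * x)))"

lemma fnorm_nonneg: "0 \<le> fnorm x"
  using C_nonneg f_nonneg by (simp add: fnorm_def)

lemma hnorm_nonneg: "a \<in> I \<Longrightarrow> 0 \<le> hnorm a"
  using nonneg by (simp add: hnorm_def)

lemma hnorm_square: "a \<in> I \<Longrightarrow> Re (h (a\<^sup>\<star> * a)) = (hnorm a)\<^sup>2"
  using nonneg by (simp add: hnorm_def)

lemma dominated_norm: "a \<in> I \<Longrightarrow> cmod (h (x\<^sup>\<star> * a)) \<le> fnorm x * hnorm a"
  using real_sqrt_le_mono[OF dominated[of a x]]
  by (simp add: hnorm_def fnorm_def real_sqrt_mult)

lemma Cauchy_Schwarz: "a \<in> I \<Longrightarrow> b \<in> I \<Longrightarrow> cmod (h (b\<^sup>\<star> * a)) \<le> hnorm b * hnorm a"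
  using real_sqrt_le_mono[OF positive_on_Cauchy_Schwarz[OF ideal pos, of a b]]
  by (simp add: hnorm_def real_sqrt_mult)

lemma hnorm_le_fnorm: "a \<in> I \<Longrightarrow> hnorm a \<le> fnorm a"
proof (rule le_of_square_le_mult)
  assume a: "a \<in> I"
  show "(hnorm a)\<^sup>2 \<le> fnorm a * hnorm a"
    using dominated_norm[OF a, of a] hnorm_square[OF a] complex_Re_le_cmod[of "h (a\<^sup>\<star> * a)"]
    by simp
qed (auto simp: hnorm_nonneg fnorm_nonneg)

text \<open>
  Representability bounds left multiplications for \<open>f\<close> only; the bound passes to \<open>h\<close> as follows. For
  \<open>p = c\<^sup>\<star> c\<close>, which is self-adjoint, the numbers \<open>h ((p\<^sup>n a)\<^sup>\<star> (p\<^sup>n a))\<close> form a log-convex sequence by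
  the Cauchy-Schwarz inequality, and they grow at most like \<open>M\<^sup>n\<close>, because \<open>h \<le> C f\<close> on squares of
  \<open>I\<close>. So already the first step grows at most by \<open>M\<close>, with no constant in front. This bounds
  \<open>p a\<close>, and \<open>c a\<close> has the squared norm \<open>h ((p a)\<^sup>\<star> a)\<close>.
\<close>

lemma hnorm_mult_bounded: "\<exists>M\<ge>0. \<forall>a\<in>I. hnorm (c * a) \<le> M * hnorm a"
proof -
  define p where "p = c\<^sup>\<star> * c"
  have p_star: "p\<^sup>\<star> = p" by (simp add: p_def star_mult star_star)
  obtain M where M: "M \<ge> 0"
    and M_bound: "\<And>y. cmod (f (y\<^sup>\<star> * p\<^sup>\<star> * p * y)) \<le> M * Re (f (y\<^sup>\<star> * y))"
    using rep unfolding representable_def by blast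
  have "hnorm (c * a) \<le> sqrt (sqrt M) * hnorm a" if a: "a \<in> I" for a
  proof -
    define u where "u n = Re (h ((p ^ n * a)\<^sup>\<star> * (p ^ n * a)))" for n
    have mem: "p ^ n * a \<in> I" for n using a ideal_rules by blast
    have "u 1 \<le> M * u 0"
    proof (rule log_convex_first_ratio_le)
      show u_nonneg: "0 \<le> u n" for n unfolding u_def by (intro nonneg mem)
      show "(u (Suc n))\<^sup>2 \<le> u n * u (Suc (Suc n))" for n
      proof -
        have "(p ^ Suc n * a)\<^sup>\<star> * (p ^ Suc n * a) = (p ^ n * a)\<^sup>\<star> * (p ^ Suc (Suc n) * a)"
          by (simp add: star_mult star_power p_star mult.assoc power_commutes)
            (metis mult.assoc power_commutes)
        then have "\<bar>u (Suc n)\<bar> \<le> cmod (h ((p ^ n * a)\<^sup>\<star> * (p ^ Suc (Suc n) * a)))"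
          unfolding u_def by (metis abs_Re_le_cmod)
        then have "(u (Suc n))\<^sup>2 \<le> (cmod (h ((p ^ n * a)\<^sup>\<star> * (p ^ Suc (Suc n) * a))))\<^sup>2"
          using abs_le_square_iff by fastforce
        also have "\<dots> \<le> u n * u (Suc (Suc n))"
          unfolding u_def by (intro positive_on_Cauchy_Schwarz[OF ideal pos] mem)
        finally show ?thesis .
      qed
      have f_growth: "Re (f ((p ^ n * a)\<^sup>\<star> * (p ^ n * a))) \<le> Re (f (a\<^sup>\<star> * a)) * M ^ n" for n
      proof (induction n)
        case (Suc n)
        have "(p ^ Suc n * a)\<^sup>\<star> * (p ^ Suc n * a) = (p ^ n * a)\<^sup>\<star> * p\<^sup>\<star> * p * (p ^ n * a)"
          by (simp add: star_mult mult.assoc)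
        then have "Re (f ((p ^ Suc n * a)\<^sup>\<star> * (p ^ Suc n * a)))
            \<le> M * Re (f ((p ^ n * a)\<^sup>\<star> * (p ^ n * a)))"
          using order_trans[OF complex_Re_le_cmod M_bound[of "p ^ n * a"]] by simp
        also have "\<dots> \<le> M * (Re (f (a\<^sup>\<star> * a)) * M ^ n)"
          using Suc M by (intro mult_left_mono)
        finally show ?case by (simp add: mult_ac)
      qed simp
      show "u n \<le> (C * Re (f (a\<^sup>\<star> * a))) * M ^ n" for n
      proof -
        have "u n \<le> C * Re (f ((p ^ n * a)\<^sup>\<star> * (p ^ n * a)))"
          using hnorm_le_fnorm[OF mem, of n] by (simp add: hnorm_def fnorm_def u_def)
        also have "\<dots> \<le> C * (Re (f (a\<^sup>\<star> * a)) * M ^ n)"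
          using f_growth C_nonneg by (intro mult_left_mono)
        finally show ?thesis by simp
      qed
    qed fact
    then have "hnorm (p * a) \<le> sqrt M * hnorm a"
      using real_sqrt_le_mono by (fastforce simp: u_def hnorm_def real_sqrt_mult)
    have "(hnorm (c * a))\<^sup>2 = Re (h ((p * a)\<^sup>\<star> * a))"
      using ideal_rules a
      by (simp add: hnorm_square[symmetric] p_def star_mult star_star mult.assoc)
    also have "\<dots> \<le> hnorm (p * a) * hnorm a"
      using order_trans[OF complex_Re_le_cmod Cauchy_Schwarz[OF a ideal_rules(5)[OF a, of p]]] .
    also have "\<dots> \<le> sqrt M * hnorm a * hnorm a"
      using \<open>hnorm (p * a) \<le> _\<close> hnorm_nonneg a by (intro mult_right_mono) auto
    also have "\<dots> = (sqrt (sqrt M) * hnorm a)\<^sup>2"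
    proof -
      have "(sqrt (sqrt M))\<^sup>2 = sqrt M" using M by simp
      then show ?thesis by (simp only: power_mult_distrib power2_eq_square[of "hnorm a"] mult.assoc)
    qed
    finally show ?thesis
      by (rule power2_le_imp_le) (use M hnorm_nonneg a in simp)
  qed
  then show ?thesis using M by (intro exI[of _ "sqrt (sqrt M)"]) auto
qed

text \<open>
  The norm of \<open>b \<mapsto> h (x\<^sup>\<star> b)\<close> as a functional on \<open>(I, hnorm)\<close> is at most \<open>e\<close>. Only upper bounds of
  this seminorm matter below, so a relation is more convenient than the supremum. On \<open>I\<close> the
  seminorm is \<open>hnorm\<close>.
\<close>

definition dual_seminorm_le :: "'a \<Rightarrow> real \<Rightarrow> bool" where
  "dual_seminorm_le x e \<longleftrightarrow> 0 \<le> e \<and> (\<forall>b\<in>I. cmod (h (x\<^sup>\<star> * b)) \<le> e * hnorm b)"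

lemma dual_seminorm_le_fnorm: "dual_seminorm_le x (fnorm x)"
  by (simp add: dual_seminorm_le_def fnorm_nonneg dominated_norm)

lemma dual_seminorm_le_add:
  assumes "dual_seminorm_le x d" "dual_seminorm_le y e"
  shows "dual_seminorm_le (x + y) (d + e)"
  unfolding dual_seminorm_le_def
proof (intro conjI ballI)
  show "0 \<le> d + e" using assms by (simp add: dual_seminorm_le_def)
  fix b assume b: "b \<in> I"
  have "h ((x + y)\<^sup>\<star> * b) = h (x\<^sup>\<star> * b) + h (y\<^sup>\<star> * b)"
    using b ideal_rules by (simp add: star_add distrib_right linear_rules)
  then have "cmod (h ((x + y)\<^sup>\<star> * b)) \<le> cmod (h (x\<^sup>\<star> * b)) + cmod (h (y\<^sup>\<star> * b))"
    by (simp add: norm_triangle_ineq)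
  also have "\<dots> \<le> d * hnorm b + e * hnorm b"
    using assms b by (intro add_mono) (auto simp: dual_seminorm_le_def)
  finally show "cmod (h ((x + y)\<^sup>\<star> * b)) \<le> (d + e) * hnorm b"
    by (simp add: distrib_right)
qed

lemma dual_seminorm_le_scale:
  assumes "dual_seminorm_le x d"
  shows "dual_seminorm_le (c *\<^sub>C x) (cmod c * d)"
  using assms ideal_rules
  by (auto simp: dual_seminorm_le_def star_scaleC mult_scaleC_left linear_rules norm_mult
      mult.assoc intro!: mult_left_mono)

lemma dual_seminorm_le_minus: "dual_seminorm_le x d \<Longrightarrow> dual_seminorm_le (- x) d"
  using dual_seminorm_le_scale[of x d "- 1"] by (simp add: scaleC_one)

lemma hnorm_le_dual_seminorm:
  assumes "a \<in> I" "dual_seminorm_le a d"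
  shows "hnorm a \<le> d"
proof (rule le_of_square_le_mult)
  show "(hnorm a)\<^sup>2 \<le> d * hnorm a"
    using assms order_trans[OF complex_Re_le_cmod, of "h (a\<^sup>\<star> * a)"]
    by (simp add: dual_seminorm_le_def flip: hnorm_square)
qed (use assms hnorm_nonneg in \<open>auto simp: dual_seminorm_le_def\<close>)

text \<open>
  Multiplication by \<open>c\<close> on the left is dual to multiplication of elements of \<open>I\<close> by \<open>c\<^sup>\<star>\<close>.
\<close>

lemma dual_seminorm_mult_bounded:
  "\<exists>M. \<forall>x d. dual_seminorm_le x d \<longrightarrow> dual_seminorm_le (c * x) (M * d)"
proof -
  obtain M where M: "M \<ge> 0" "\<And>a. a \<in> I \<Longrightarrow> hnorm (c\<^sup>\<star> * a) \<le> M * hnorm a"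
    using hnorm_mult_bounded by blast
  have "dual_seminorm_le (c * x) (M * d)" if xd: "dual_seminorm_le x d" for x d
    unfolding dual_seminorm_le_def
  proof (intro conjI ballI)
    show "0 \<le> M * d" using M xd by (simp add: dual_seminorm_le_def)
    fix b assume b: "b \<in> I"
    then have "cmod (h ((c * x)\<^sup>\<star> * b)) \<le> d * hnorm (c\<^sup>\<star> * b)"
      using xd ideal_rules by (simp add: dual_seminorm_le_def star_mult mult.assoc)
    also have "\<dots> \<le> d * (M * hnorm b)"
      using xd b M by (intro mult_left_mono) (auto simp: dual_seminorm_le_def)
    finally show "cmod (h ((c * x)\<^sup>\<star> * b)) \<le> M * d * hnorm b" by (simp add: mult_ac)
  qed
  then show ?thesis by blast
qed

text \<open>
  The Riesz representation theorem up to \<open>e\<close>: an \<open>a \<in> I\<close> that maximizes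
  \<open>2 Re h (x\<^sup>\<star> a) - h (a\<^sup>\<star> a)\<close> up to \<open>e\<^sup>2\<close> almost represents \<open>b \<mapsto> h (x\<^sup>\<star> b)\<close>. Moving from \<open>a\<close> to
  \<open>a + t b\<close> gains at most \<open>e\<^sup>2\<close>, and the part of the gain that is linear in \<open>t\<close> is
  \<open>2 Re (t h ((x - a)\<^sup>\<star> b))\<close>.
\<close>

lemma ideal_dense:
  assumes "0 < e"
  shows "\<exists>a\<in>I. dual_seminorm_le (x - a) e"
proof -
  define F where "F a = 2 * Re (h (x\<^sup>\<star> * a)) - Re (h (a\<^sup>\<star> * a))" for a
  have F_le: "F a \<le> (fnorm x)\<^sup>2" if "a \<in> I" for a
  proof -
    have "F a \<le> 2 * (fnorm x * hnorm a) - (hnorm a)\<^sup>2"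
      using order_trans[OF complex_Re_le_cmod dominated_norm[OF that, of x]]
        hnorm_square[OF that] by (simp add: F_def)
    also have "\<dots> = (fnorm x)\<^sup>2 - (fnorm x - hnorm a)\<^sup>2"
      by (simp add: power2_eq_square algebra_simps)
    also have "\<dots> \<le> (fnorm x)\<^sup>2" by simp
    finally show ?thesis .
  qed
  define s where "s = (SUP a\<in>I. F a)"
  have bdd: "bdd_above (F ` I)" using F_le by (auto intro!: bdd_aboveI2)
  have "I \<noteq> {}" using ideal_rules(1) by auto
  have "s - e\<^sup>2 < s" using assms by simp
  then obtain a where a: "a \<in> I" "s - e\<^sup>2 < F a"
    using less_cSUP_iff[OF \<open>I \<noteq> {}\<close> bdd, of "s - e\<^sup>2"] unfolding s_def by blast
  have "cmod (h ((x - a)\<^sup>\<star> * b)) \<le> e * hnorm b" if b: "b \<in> I" for b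
  proof -
    have "2 * Re (t * h ((x - a)\<^sup>\<star> * b)) - (cmod t)\<^sup>2 * Re (h (b\<^sup>\<star> * b)) \<le> e\<^sup>2" for t
    proof -
      have "F (a + t *\<^sub>C b) \<le> s"
        unfolding s_def using a b ideal_rules bdd by (intro cSUP_upper) auto
      moreover have "Re (cnj t * t * h (b\<^sup>\<star> * b)) = (cmod t)\<^sup>2 * Re (h (b\<^sup>\<star> * b))"
        by (subst mult.commute[of "cnj t"], subst complex_norm_square[symmetric]) simp
      moreover have "Re (cnj t * h (b\<^sup>\<star> * a)) = Re (t * h (a\<^sup>\<star> * b))"
        using sym[OF a(1) b] by simp
      moreover have "Re (h ((a + t *\<^sub>C b)\<^sup>\<star> * (a + t *\<^sub>C b)))
          = Re (h (a\<^sup>\<star> * a)) + Re (t * h (a\<^sup>\<star> * b)) + Re (cnj t * h (b\<^sup>\<star> * a))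
            + Re (cnj t * t * h (b\<^sup>\<star> * b))"
        by (simp only: linear_on_square_add[OF ideal linear_on a(1) b] plus_complex.simps)
      moreover have "Re (h (x\<^sup>\<star> * (a + t *\<^sub>C b))) = Re (h (x\<^sup>\<star> * a)) + Re (t * h (x\<^sup>\<star> * b))"
        using a(1) b ideal_rules(4,5)
        by (simp add: distrib_left mult_scaleC_right linear_rules del: times_complex.simps)
      ultimately have "F a + 2 * Re (t * (h (x\<^sup>\<star> * b) - h (a\<^sup>\<star> * b)))
          - (cmod t)\<^sup>2 * Re (h (b\<^sup>\<star> * b)) \<le> s"
        unfolding F_def right_diff_distrib minus_complex.simps by linarith
      moreover have "h ((x - a)\<^sup>\<star> * b) = h (x\<^sup>\<star> * b) - h (a\<^sup>\<star> * b)"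
        using a b ideal_rules by (simp add: star_diff left_diff_distrib linear_rules)
      ultimately show ?thesis using a(2) by simp
    qed
    from cmod_square_le_of_quadratic_bound[OF this nonneg[OF b]]
    have "(cmod (h ((x - a)\<^sup>\<star> * b)))\<^sup>2 \<le> (e * hnorm b)\<^sup>2"
      using hnorm_square[OF b] by (simp add: power_mult_distrib mult.commute)
    then show ?thesis
      by (rule power2_le_imp_le) (use assms hnorm_nonneg b in simp)
  qed
  with a assms show ?thesis by (auto simp: dual_seminorm_le_def)
qed

definition approximates :: "(nat \<Rightarrow> 'a) \<Rightarrow> 'a \<Rightarrow> bool" where
  "approximates a x \<longleftrightarrow> range a \<subseteq> I \<and> (\<exists>d. d \<longlonglongrightarrow> 0 \<and> (\<forall>n. dual_seminorm_le (x - a n) (d n)))"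

lemma approximates_mem: "approximates a x \<Longrightarrow> a n \<in> I"
  by (auto simp: approximates_def)

lemma approximates_exists: "\<exists>a. approximates a x"
proof -
  have "\<exists>a. \<forall>n. a n \<in> I \<and> dual_seminorm_le (x - a n) (inverse (real (Suc n)))"
  proof (intro choice allI)
    fix n
    have "0 < inverse (real (Suc n))" by simp
    from ideal_dense[OF this]
    show "\<exists>y. y \<in> I \<and> dual_seminorm_le (x - y) (inverse (real (Suc n)))" by blast
  qed
  then show ?thesis
    using LIMSEQ_inverse_real_of_nat by (auto simp: approximates_def image_subset_iff)
qed

lemma approximatesI:
  "(\<And>n. a n \<in> I) \<Longrightarrow> d \<longlonglongrightarrow> 0 \<Longrightarrow> (\<And>n. dual_seminorm_le (x - a n) (d n)) \<Longrightarrow> approximates a x"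
  by (auto simp: approximates_def)

lemma approximates_const: "x \<in> I \<Longrightarrow> approximates (\<lambda>n. x) x"
  unfolding approximates_def
  using ideal_rules(1) by (auto simp: dual_seminorm_le_def linear_rules intro!: exI[of _ "\<lambda>n. 0"])

lemma approximates_add:
  assumes "approximates a x" "approximates b y"
  shows "approximates (\<lambda>n. a n + b n) (x + y)"
proof -
  obtain d e where de: "d \<longlonglongrightarrow> 0" "e \<longlonglongrightarrow> 0" "\<And>n. dual_seminorm_le (x - a n) (d n)"
    "\<And>n. dual_seminorm_le (y - b n) (e n)"
    using assms by (auto simp: approximates_def)
  show ?thesis
  proof (rule approximatesI)
    show "a n + b n \<in> I" for n
      using assms by (intro ideal_rules(2) approximates_mem)
    show "(\<lambda>n. d n + e n) \<longlonglongrightarrow> 0"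
      using tendsto_add[OF de(1,2)] by simp
    show "dual_seminorm_le (x + y - (a n + b n)) (d n + e n)" for n
      using dual_seminorm_le_add[OF de(3)[of n] de(4)[of n]] by (simp add: algebra_simps)
  qed
qed

lemma approximates_scale:
  assumes "approximates a x"
  shows "approximates (\<lambda>n. c *\<^sub>C a n) (c *\<^sub>C x)"
proof -
  obtain d where d: "d \<longlonglongrightarrow> 0" "\<And>n. dual_seminorm_le (x - a n) (d n)"
    using assms by (auto simp: approximates_def)
  show ?thesis
  proof (rule approximatesI)
    show "c *\<^sub>C a n \<in> I" for n
      using assms by (intro ideal_rules(4) approximates_mem)
    show "(\<lambda>n. cmod c * d n) \<longlonglongrightarrow> 0"
      using d(1) by (rule tendsto_mult_right_zero)
    show "dual_seminorm_le (c *\<^sub>C x - c *\<^sub>C a n) (cmod c * d n)" for n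
      using dual_seminorm_le_scale[OF d(2)[of n]] by (simp add: cvs.scale_right_diff_distrib)
  qed
qed

lemma approximates_mult:
  assumes "approximates a x"
  shows "approximates (\<lambda>n. c * a n) (c * x)"
proof -
  obtain d where d: "d \<longlonglongrightarrow> 0" "\<And>n. dual_seminorm_le (x - a n) (d n)"
    using assms by (auto simp: approximates_def)
  obtain M where M: "\<And>x d. dual_seminorm_le x d \<Longrightarrow> dual_seminorm_le (c * x) (M * d)"
    using dual_seminorm_mult_bounded by blast
  show ?thesis
  proof (rule approximatesI)
    show "c * a n \<in> I" for n
      using assms by (intro ideal_rules(5) approximates_mem)
    show "(\<lambda>n. M * d n) \<longlonglongrightarrow> 0"
      using d(1) by (rule tendsto_mult_right_zero)
    show "dual_seminorm_le (c * x - c * a n) (M * d n)" for n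
      using M[OF d(2)[of n]] by (simp add: right_diff_distrib)
  qed
qed

text \<open>
  The functional \<open>h\<close> is \<open>a \<mapsto> h (1\<^sup>\<star> a)\<close>, hence continuous for the dual seminorm with norm at most
  \<open>fnorm 1\<close>.
\<close>

lemma h_bound: "a \<in> I \<Longrightarrow> dual_seminorm_le a d \<Longrightarrow> cmod (h a) \<le> fnorm 1 * d"
  using order_trans[OF dominated_norm[of a 1] mult_left_mono[OF hnorm_le_dual_seminorm fnorm_nonneg]]
  by simp

lemma approximates_h_diff:
  assumes "approximates a x" "approximates b x"
  obtains d e where "d \<longlonglongrightarrow> 0" "e \<longlonglongrightarrow> 0"
    "\<And>n m. cmod (h (a n) - h (b m)) \<le> d n + e m"
proof -
  obtain d e where d: "d \<longlonglongrightarrow> 0" "\<And>n. dual_seminorm_le (x - a n) (d n)"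
    and e: "e \<longlonglongrightarrow> 0" "\<And>n. dual_seminorm_le (x - b n) (e n)"
    using assms by (auto simp: approximates_def)
  show ?thesis
  proof (rule that)
    show "(\<lambda>n. fnorm 1 * d n) \<longlonglongrightarrow> 0" "(\<lambda>n. fnorm 1 * e n) \<longlonglongrightarrow> 0"
      using d(1) e(1) by (auto intro: tendsto_mult_right_zero)
    fix n m
    have "dual_seminorm_le (a n - b m) (d n + e m)"
      using dual_seminorm_le_add[OF dual_seminorm_le_minus[OF d(2)[of n]] e(2)[of m]] by simp
    then have "cmod (h (a n - b m)) \<le> fnorm 1 * (d n + e m)"
      using approximates_mem[OF assms(1)] approximates_mem[OF assms(2)]
      by (intro h_bound ideal_rules(3))
    then show "cmod (h (a n) - h (b m)) \<le> fnorm 1 * d n + fnorm 1 * e m"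
      using approximates_mem[OF assms(1)] approximates_mem[OF assms(2)]
      by (simp add: linear_rules distrib_left)
  qed
qed

lemma approximates_convergent:
  assumes "approximates a x"
  shows "convergent (\<lambda>n. h (a n))"
proof -
  obtain d e where d: "d \<longlonglongrightarrow> 0" "e \<longlonglongrightarrow> 0"
    and diff: "\<And>n m. cmod (h (a n) - h (a m)) \<le> d n + e m"
    using approximates_h_diff[OF assms assms] by metis
  have "Cauchy (\<lambda>n. h (a n))"
  proof (rule metric_CauchyI)
    fix r :: real assume "0 < r"
    then have "eventually (\<lambda>n. d n < r / 2 \<and> e n < r / 2) sequentially"
      using order_tendstoD(2)[OF d(1), of "r / 2"] order_tendstoD(2)[OF d(2), of "r / 2"]
      by (auto intro: eventually_conj)
    then obtain N where N: "\<And>n. n \<ge> N \<Longrightarrow> d n < r / 2 \<and> e n < r / 2"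
      by (auto simp: eventually_sequentially)
    have "dist (h (a m)) (h (a n)) < r" if "m \<ge> N" "n \<ge> N" for m n
      using N[OF that(1)] N[OF that(2)] diff[of m n] unfolding dist_norm by linarith
    then show "\<exists>N. \<forall>m\<ge>N. \<forall>n\<ge>N. dist (h (a m)) (h (a n)) < r" by blast
  qed
  then show ?thesis by (simp add: Cauchy_convergent)
qed

text \<open>
  The extension of \<open>h\<close> by continuity. The limit is the same for all approximating sequences, see
  \<open>ext_limit\<close>.
\<close>

definition ext :: "'a \<Rightarrow> complex" where
  "ext x = lim (\<lambda>n. h ((SOME a. approximates a x) n))"

lemma ext_limit:
  assumes "approximates a x"
  shows "(\<lambda>n. h (a n)) \<longlonglongrightarrow> ext x"
proof -
  define b where "b = (SOME a. approximates a x)"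
  have b: "approximates b x"
    unfolding b_def using approximates_exists by (rule someI_ex)
  have "(\<lambda>n. h (b n)) \<longlonglongrightarrow> ext x"
    using approximates_convergent[OF b] by (simp add: ext_def b_def convergent_LIMSEQ_iff)
  moreover have "(\<lambda>n. h (a n) - h (b n)) \<longlonglongrightarrow> 0"
  proof -
    obtain d e where "d \<longlonglongrightarrow> 0" "e \<longlonglongrightarrow> 0"
      and diff: "\<And>n m. cmod (h (a n) - h (b m)) \<le> d n + e m"
      using approximates_h_diff[OF assms b] by metis
    then have "(\<lambda>n. d n + e n) \<longlonglongrightarrow> 0"
      using tendsto_add[of d 0 sequentially e 0] by simp
    then show ?thesis
      by (rule Lim_null_comparison[rotated]) (simp add: diff)
  qed
  ultimately show ?thesis
    using tendsto_add[of "\<lambda>n. h (a n) - h (b n)" 0 sequentially "\<lambda>n. h (b n)" "ext x"] by simp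
qed

lemma ext_extends: "a \<in> I \<Longrightarrow> ext a = h a"
  by (rule LIMSEQ_unique[OF ext_limit[OF approximates_const] tendsto_const])

lemma ext_dual: "ext \<in> dual"
  unfolding linear_functional_on_UNIV[symmetric] linear_functional_on_def
proof (intro conjI ballI allI)
  fix x y :: 'a and c :: complex
  obtain a b where a: "approximates a x" and b: "approximates b y"
    using approximates_exists by blast
  have "(\<lambda>n. h (a n + b n)) \<longlonglongrightarrow> ext x + ext y"
    using tendsto_add[OF ext_limit[OF a] ext_limit[OF b]] approximates_mem[OF a]
      approximates_mem[OF b] by (simp add: linear_rules)
  with ext_limit[OF approximates_add[OF a b]] show "ext (x + y) = ext x + ext y"
    by (rule LIMSEQ_unique)
  have "(\<lambda>n. h (c *\<^sub>C a n)) \<longlonglongrightarrow> c * ext x"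
    using tendsto_mult[OF tendsto_const ext_limit[OF a], of c] approximates_mem[OF a]
    by (simp add: linear_rules)
  with ext_limit[OF approximates_scale[OF a]] show "ext (c *\<^sub>C x) = c * ext x"
    by (rule LIMSEQ_unique)
qed

text \<open>
  By \<open>approximates_mult\<close>, \<open>ext (x\<^sup>\<star> x)\<close> is the limit of \<open>h (x\<^sup>\<star> a\<^sub>n)\<close>. Replacing the remaining \<open>x\<close> by
  \<open>a\<^sub>n\<close> changes this by at most the dual seminorm of \<open>x - a\<^sub>n\<close> times \<open>hnorm a\<^sub>n\<close>, where the second
  factor stays bounded.
\<close>

lemma ext_square_limit:
  assumes "approximates a x"
  shows "(\<lambda>n. h ((a n)\<^sup>\<star> * a n)) \<longlonglongrightarrow> ext (x\<^sup>\<star> * x)"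
proof -
  obtain d where d: "d \<longlonglongrightarrow> 0" "\<And>n. dual_seminorm_le (x - a n) (d n)"
    using assms by (auto simp: approximates_def)
  have mem: "a n \<in> I" for n using assms by (rule approximates_mem)
  have d_nonneg: "0 \<le> d n" for n using d(2) by (simp add: dual_seminorm_le_def)
  have diff: "cmod (h ((a n)\<^sup>\<star> * a n) - h (x\<^sup>\<star> * a n)) \<le> d n * (fnorm x + d n)" for n
  proof -
    have "dual_seminorm_le (a n) (fnorm x + d n)"
      using dual_seminorm_le_add[OF dual_seminorm_le_fnorm[of x]
          dual_seminorm_le_minus[OF d(2)[of n]]] by simp
    then have hn: "hnorm (a n) \<le> fnorm x + d n" using mem hnorm_le_dual_seminorm by blast
    have "h ((a n)\<^sup>\<star> * a n) - h (x\<^sup>\<star> * a n) = - h ((x - a n)\<^sup>\<star> * a n)"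
      using mem ideal_rules by (simp add: star_diff left_diff_distrib linear_rules)
    then have "cmod (h ((a n)\<^sup>\<star> * a n) - h (x\<^sup>\<star> * a n)) \<le> d n * hnorm (a n)"
      using d(2)[of n] mem[of n] by (simp add: dual_seminorm_le_def)
    also have "\<dots> \<le> d n * (fnorm x + d n)"
      using hn d_nonneg by (rule mult_left_mono)
    finally show ?thesis .
  qed
  have "(\<lambda>n. d n * (fnorm x + d n)) \<longlonglongrightarrow> 0 * (fnorm x + 0)"
    by (intro tendsto_mult tendsto_add tendsto_const d)
  then have "(\<lambda>n. d n * (fnorm x + d n)) \<longlonglongrightarrow> 0" by simp
  then have "(\<lambda>n. h ((a n)\<^sup>\<star> * a n) - h (x\<^sup>\<star> * a n)) \<longlonglongrightarrow> 0"
    by (rule Lim_null_comparison[rotated]) (simp add: diff)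
  from tendsto_add[OF this ext_limit[OF approximates_mult[OF assms, of "x\<^sup>\<star>"]]]
  show ?thesis by simp
qed

lemma ext_positive: "positive_functional ext"
  unfolding positive_functional_def
proof (intro conjI allI ext_dual)
  fix x
  obtain a where a: "approximates a x" using approximates_exists by blast
  have lim: "(\<lambda>n. h ((a n)\<^sup>\<star> * a n)) \<longlonglongrightarrow> ext (x\<^sup>\<star> * x)"
    using a by (rule ext_square_limit)
  have "0 \<le> Re (ext (x\<^sup>\<star> * x))"
    by (rule LIMSEQ_le_const[OF tendsto_Re[OF lim]])
      (use nonneg[OF approximates_mem[OF a]] in blast)
  moreover have "(\<lambda>n. Im (h ((a n)\<^sup>\<star> * a n))) = (\<lambda>n. 0)"
    using square_real[OF approximates_mem[OF a]] by simp
  then have "Im (ext (x\<^sup>\<star> * x)) = 0"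
    using tendsto_Im[OF lim] by (simp add: LIMSEQ_const_iff)
  ultimately show "0 \<le> ext (x\<^sup>\<star> * x)" by (simp add: less_eq_complex_def)
qed

text \<open>
  In the limit along a sequence approximating \<open>x\<close> the hypothesis becomes
  \<open>ext (x\<^sup>\<star> x)\<^sup>2 \<le> K * ext (x\<^sup>\<star> x)\<close>. Taking \<open>K = C f (x\<^sup>\<star> x)\<close> gives \<open>ext \<le> C f\<close>, and taking
  \<open>K = r (x\<^sup>\<star> x)\<close> for another positive extension \<open>r\<close> of \<open>h\<close> gives minimality.
\<close>

lemma ext_square_le:
  assumes bound: "\<And>a. a \<in> I \<Longrightarrow> (cmod (h (x\<^sup>\<star> * a)))\<^sup>2 \<le> K * Re (h (a\<^sup>\<star> * a))" and "0 \<le> K"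
  shows "Re (ext (x\<^sup>\<star> * x)) \<le> K"
proof -
  obtain a where a: "approximates a x" using approximates_exists by blast
  have "(\<lambda>n. (cmod (h (x\<^sup>\<star> * a n)))\<^sup>2) \<longlonglongrightarrow> (cmod (ext (x\<^sup>\<star> * x)))\<^sup>2"
    by (intro tendsto_power tendsto_norm ext_limit approximates_mult a)
  moreover have "(\<lambda>n. K * Re (h ((a n)\<^sup>\<star> * a n))) \<longlonglongrightarrow> K * Re (ext (x\<^sup>\<star> * x))"
    by (intro tendsto_mult tendsto_const tendsto_Re ext_square_limit a)
  ultimately have "(cmod (ext (x\<^sup>\<star> * x)))\<^sup>2 \<le> K * Re (ext (x\<^sup>\<star> * x))"
    using bound[OF approximates_mem[OF a]] by (auto intro: LIMSEQ_le)
  moreover have "0 \<le> ext (x\<^sup>\<star> * x)"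
    using ext_positive by (simp add: positive_functional_def)
  then have "0 \<le> Re (ext (x\<^sup>\<star> * x))" "cmod (ext (x\<^sup>\<star> * x)) = Re (ext (x\<^sup>\<star> * x))"
    by (auto simp: less_eq_complex_def cmod_eq_Re)
  ultimately show ?thesis using le_of_square_le_mult[of _ K] \<open>0 \<le> K\<close> by metis
qed

end

lemma dual_combination:
  assumes "g \<in> dual" "k \<in> dual"
  shows "(\<lambda>x. c * g x + d * k x) \<in> dual"
  using assms by (simp add: linear_functional_on_UNIV[symmetric] linear_functional_on_def algebra_simps)

lemma functional_leI:
  assumes "g \<in> dual" "k \<in> dual" "\<And>x. 0 \<le> k (x\<^sup>\<star> * x) - g (x\<^sup>\<star> * x)"
  shows "g \<preceq> k"
  using dual_combination[OF assms(2,1), of 1 "- 1"] assms(3)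
  by (simp add: functional_le_def positive_functional_def)

lemma minimal_positive_extension:
  assumes "left_ideal I" "representable f" "positive_on I h" "0 \<le> C"
    and "\<And>x a. a \<in> I \<Longrightarrow>
      (cmod (h (x\<^sup>\<star> * a)))\<^sup>2 \<le> C * Re (f (x\<^sup>\<star> * x)) * Re (h (a\<^sup>\<star> * a))"
  obtains k where "positive_functional k" "extends I h k" "k \<preceq> (\<lambda>x. of_real C * f x)"
    "\<And>r. positive_functional r \<Longrightarrow> extends I h r \<Longrightarrow> k \<preceq> r"
proof -
  interpret dominated_positive_functional I f h C
    using assms by unfold_locales
  have ext_real: "0 \<le> Re (ext (x\<^sup>\<star> * x))" "Im (ext (x\<^sup>\<star> * x)) = 0" for x
    using ext_positive by (auto simp: positive_functional_def less_eq_complex_def)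
  have f: "f \<in> dual" "Im (f (x\<^sup>\<star> * x)) = 0" for x
    using f_positive by (auto simp: positive_functional_def less_eq_complex_def)
  show ?thesis
  proof (rule that)
    show "positive_functional ext" by (rule ext_positive)
    show "extends I h ext" by (simp add: extends_def ext_extends)
    show "ext \<preceq> (\<lambda>x. of_real C * f x)"
    proof (rule functional_leI)
      show "(\<lambda>x. of_real C * f x) \<in> dual"
        using dual_combination[OF f(1) f(1), of "of_real C" 0] by simp
      show "0 \<le> of_real C * f (x\<^sup>\<star> * x) - ext (x\<^sup>\<star> * x)" for x
        using ext_square_le[of x "C * Re (f (x\<^sup>\<star> * x))"] dominated C_nonneg f_nonneg
        by (simp add: less_eq_complex_def ext_real f)
    qed (rule ext_dual)
    fix r assume r: "positive_functional r" "extends I h r"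
    have r_real: "0 \<le> Re (r (x\<^sup>\<star> * x))" "Im (r (x\<^sup>\<star> * x)) = 0" for x
      using r by (auto simp: positive_functional_def less_eq_complex_def)
    show "ext \<preceq> r"
    proof (rule functional_leI)
      show "r \<in> dual" using r by (simp add: positive_functional_def)
      fix x
      have "(cmod (h (x\<^sup>\<star> * a)))\<^sup>2 \<le> Re (r (x\<^sup>\<star> * x)) * Re (h (a\<^sup>\<star> * a))" if "a \<in> I" for a
        using positive_functional_Cauchy_Schwarz[OF r(1), of x a] r(2) that ideal_rules
        by (simp add: extends_def)
      then show "0 \<le> r (x\<^sup>\<star> * x) - ext (x\<^sup>\<star> * x)"
        using ext_square_le[of x "Re (r (x\<^sup>\<star> * x))"] r_real
        by (simp add: less_eq_complex_def ext_real)
    qed (rule ext_dual)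
  qed
qed

section \<open>Bound preserving extensions as an order interval\<close>

lemma bounding_constant_imp_positive:
  fixes \<alpha> s :: real
  assumes f: "positive_functional f" and g: "linear_functional_on I g"
    "symmetric_on I g" and b: "bounding_constant f I g \<alpha>" "0 \<le> \<alpha>" and s: "s = 1 \<or> s = - 1"
  shows "positive_on I (\<lambda>x. of_real \<alpha> * f x + of_real s * g x)"
  unfolding positive_on_def
proof (intro conjI ballI)
  have "linear_functional_on UNIV f"
    using f by (simp add: positive_functional_def linear_functional_on_UNIV)
  then show "linear_functional_on I (\<lambda>x. of_real \<alpha> * f x + of_real s * g x)"
    using g(1) by (simp add: linear_functional_on_def algebra_simps)
  fix a assume a: "a \<in> I"
  have f_real: "0 \<le> Re (f (a\<^sup>\<star> * a))" "Im (f (a\<^sup>\<star> * a)) = 0"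
    using f by (auto simp: positive_functional_def less_eq_complex_def)
  have "g (a\<^sup>\<star> * a) = cnj (g (a\<^sup>\<star> * a))"
    using g(2) a unfolding symmetric_on_def by blast
  then have g_real: "Im (g (a\<^sup>\<star> * a)) = 0" by (simp add: complex_eq_iff)
  have "(cmod (g (a\<^sup>\<star> * a)))\<^sup>2 \<le> (\<alpha> * Re (f (a\<^sup>\<star> * a)))\<^sup>2"
    using b(1) a by (simp add: bounding_constant_def power2_eq_square mult_ac)
  then have "cmod (g (a\<^sup>\<star> * a)) \<le> \<alpha> * Re (f (a\<^sup>\<star> * a))"
    by (rule power2_le_imp_le) (use b f_real in simp)
  then have "\<bar>Re (g (a\<^sup>\<star> * a))\<bar> \<le> \<alpha> * Re (f (a\<^sup>\<star> * a))"
    using abs_Re_le_cmod order_trans by blast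
  then show "0 \<le> of_real \<alpha> * f (a\<^sup>\<star> * a) + of_real s * g (a\<^sup>\<star> * a)"
    using s by (auto simp: less_eq_complex_def f_real g_real)
qed

text \<open>
  In terms of a symmetric operator \<open>S\<close> of norm at most \<open>\<alpha>\<close> this is
  \<open>\<parallel>\<alpha> a + S a\<parallel>\<^sup>2 = \<alpha>\<^sup>2 \<parallel>a\<parallel>\<^sup>2 + 2 \<alpha> \<langle>S a, a\<rangle> + \<parallel>S a\<parallel>\<^sup>2 \<le> 2 \<alpha> \<langle>\<alpha> a + S a, a\<rangle>\<close>. The vector \<open>S a\<close> need not lie
  in the algebra, so \<open>\<parallel>S a\<parallel>\<^sup>2 \<le> \<alpha>\<^sup>2 \<parallel>a\<parallel>\<^sup>2\<close> is used in the form
  \<open>2 Re \<langle>S a, y\<rangle> - \<parallel>y\<parallel>\<^sup>2 \<le> \<alpha>\<^sup>2 \<parallel>a\<parallel>\<^sup>2\<close> for all \<open>y\<close> in the algebra. The sign \<open>s\<close> treats \<open>S\<close> and \<open>- S\<close>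
  at the same time.
\<close>

lemma bounding_constant_imp_dominated:
  fixes \<alpha> s :: real
  assumes f: "positive_functional f" and I: "left_ideal I" and g: "linear_functional_on I g"
    and b: "bounding_constant f I g \<alpha>" "0 \<le> \<alpha>" and s: "s = 1 \<or> s = - 1"
    and h: "h = (\<lambda>x. of_real \<alpha> * f x + of_real s * g x)" and a: "a \<in> I"
  shows "(cmod (h (x\<^sup>\<star> * a)))\<^sup>2 \<le> (2 * \<alpha>) * Re (f (x\<^sup>\<star> * x)) * Re (h (a\<^sup>\<star> * a))"
proof -
  have f_lin: "linear_functional_on UNIV f"
    using f by (simp add: positive_functional_def linear_functional_on_UNIV)
  have f_nonneg: "0 \<le> Re (f (y\<^sup>\<star> * y))" for y
    using f by (auto simp: positive_functional_def less_eq_complex_def)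
  have f_sym: "f (y\<^sup>\<star> * z) = cnj (f (z\<^sup>\<star> * y))" for y z
    using positive_functional_hermitian[OF f] unfolding hermitian_def
    by (metis star_mult star_star)
  note f_rules = linear_functional_onD[OF left_ideal_UNIV f_lin]
  note g_rules = linear_functional_onD[OF I g] left_idealD[OF I]
  have "2 * Re (t * h (x\<^sup>\<star> * a)) - (cmod t)\<^sup>2 * Re (f (x\<^sup>\<star> * x)) \<le> 2 * \<alpha> * Re (h (a\<^sup>\<star> * a))" for t
  proof -
    \<comment> \<open>With this shift, \<open>\<parallel>y\<parallel>\<^sup>2\<close> contributes the cross term that turns \<open>S a\<close> into \<open>\<alpha> a + S a\<close>.\<close>
    define y where "y = complex_of_real (- \<alpha>) *\<^sub>C a + cnj t *\<^sub>C x"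
    define G where "G = s * Re (g (y\<^sup>\<star> * a))"
    define A where "A = Re (f (a\<^sup>\<star> * a))"
    define Y where "Y = Re (f (y\<^sup>\<star> * y))"
    have "0 \<le> A" "0 \<le> Y" using f_nonneg by (auto simp: A_def Y_def)
    have "G \<le> cmod (g (y\<^sup>\<star> * a))"
      using s abs_Re_le_cmod[of "g (y\<^sup>\<star> * a)"] by (auto simp: G_def)
    also have "cmod (g (y\<^sup>\<star> * a)) \<le> \<alpha> * sqrt A * sqrt Y"
    proof (rule power2_le_imp_le)
      show "(cmod (g (y\<^sup>\<star> * a)))\<^sup>2 \<le> (\<alpha> * sqrt A * sqrt Y)\<^sup>2"
      proof -
        have "(cmod (g (y\<^sup>\<star> * a)))\<^sup>2 \<le> \<alpha>\<^sup>2 * Y * A"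
          using b(1) a unfolding bounding_constant_def A_def Y_def by blast
        then show ?thesis
          using \<open>0 \<le> A\<close> \<open>0 \<le> Y\<close> by (simp add: power_mult_distrib mult_ac)
      qed
    qed (use b \<open>0 \<le> A\<close> \<open>0 \<le> Y\<close> in simp)
    finally have "2 * G - Y \<le> 2 * (\<alpha> * sqrt A * sqrt Y) - (sqrt Y)\<^sup>2"
      using \<open>0 \<le> Y\<close> by simp
    also have "\<dots> = \<alpha>\<^sup>2 * (sqrt A)\<^sup>2 - (\<alpha> * sqrt A - sqrt Y)\<^sup>2"
      by (simp add: power2_eq_square algebra_simps)
    also have "\<dots> \<le> \<alpha>\<^sup>2 * A" using \<open>0 \<le> A\<close> by simp
    finally have main: "2 * G - Y \<le> \<alpha>\<^sup>2 * A" .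
    have G: "G = s * Re (t * g (x\<^sup>\<star> * a)) - \<alpha> * (s * Re (g (a\<^sup>\<star> * a)))"
      using a by (simp add: G_def y_def star_diff star_add star_scaleC distrib_right left_diff_distrib
          mult_scaleC_left g_rules algebra_simps)
    have "f (y\<^sup>\<star> * y) = of_real (\<alpha>\<^sup>2) * f (a\<^sup>\<star> * a) - of_real \<alpha> * (cnj t * f (a\<^sup>\<star> * x))
        - of_real \<alpha> * (t * f (x\<^sup>\<star> * a)) + cnj t * t * f (x\<^sup>\<star> * x)"
      by (simp add: y_def star_add star_minus star_scaleC distrib_left distrib_right
          mult_scaleC_left mult_scaleC_right f_rules right_diff_distrib left_diff_distrib star_diff
          power2_eq_square algebra_simps)
    moreover have Re_scale: "Re (complex_of_real r * z) = r * Re z" for r z by simp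
    moreover have "Re (cnj t * t * f (x\<^sup>\<star> * x)) = (cmod t)\<^sup>2 * Re (f (x\<^sup>\<star> * x))"
      by (subst mult.commute[of "cnj t"], subst complex_norm_square[symmetric]) simp
    moreover have "Re (cnj t * f (a\<^sup>\<star> * x)) = Re (t * f (x\<^sup>\<star> * a))"
      using f_sym[of a x] by simp
    ultimately have Y: "Y = \<alpha>\<^sup>2 * A - 2 * \<alpha> * Re (t * f (x\<^sup>\<star> * a)) + (cmod t)\<^sup>2 * Re (f (x\<^sup>\<star> * x))"
      unfolding Y_def A_def
      by (simp only: Re_scale plus_complex.simps minus_complex.simps)
    have ht: "Re (t * h (x\<^sup>\<star> * a)) = \<alpha> * Re (t * f (x\<^sup>\<star> * a)) + s * Re (t * g (x\<^sup>\<star> * a))"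
      by (simp add: h algebra_simps)
    have ha: "2 * \<alpha> * Re (h (a\<^sup>\<star> * a)) = 2 * (\<alpha>\<^sup>2 * A) + 2 * (\<alpha> * (s * Re (g (a\<^sup>\<star> * a))))"
      by (simp add: h A_def algebra_simps power2_eq_square)
    show ?thesis using main unfolding G Y ht ha by (simp add: algebra_simps)
  qed
  from cmod_square_le_of_quadratic_bound[OF this f_nonneg] show ?thesis by (simp add: mult_ac)
qed

text \<open>
  Write \<open>2 g\<close> as the difference of \<open>\<alpha> f + g\<close> and \<open>\<alpha> f - g\<close>, apply the Cauchy-Schwarz inequality to
  both, and then once more in the plane; the two functionals add up to \<open>2 \<alpha> f\<close>.
\<close>

lemma positive_imp_bounding_constant:
  fixes \<alpha> :: real
  assumes P: "positive_functional (\<lambda>x. of_real \<alpha> * f x + g x)"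
    and N: "positive_functional (\<lambda>x. of_real \<alpha> * f x - g x)"
  shows "bounding_constant f UNIV g \<alpha>"
  unfolding bounding_constant_def
proof (intro allI ballI)
  fix x y :: 'a
  define p where "p z = Re (of_real \<alpha> * f (z\<^sup>\<star> * z) + g (z\<^sup>\<star> * z))" for z :: 'a
  define n where "n z = Re (of_real \<alpha> * f (z\<^sup>\<star> * z) - g (z\<^sup>\<star> * z))" for z :: 'a
  have nonneg: "0 \<le> p z" "0 \<le> n z" for z
    using P N by (auto simp: positive_functional_def less_eq_complex_def p_def n_def)
  have sum: "p z + n z = 2 * \<alpha> * Re (f (z\<^sup>\<star> * z))" for z by (simp add: p_def n_def)
  have "2 * g (x\<^sup>\<star> * y) = (of_real \<alpha> * f (x\<^sup>\<star> * y) + g (x\<^sup>\<star> * y))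
      - (of_real \<alpha> * f (x\<^sup>\<star> * y) - g (x\<^sup>\<star> * y))" by simp
  then have "2 * cmod (g (x\<^sup>\<star> * y)) \<le> cmod (of_real \<alpha> * f (x\<^sup>\<star> * y) + g (x\<^sup>\<star> * y))
      + cmod (of_real \<alpha> * f (x\<^sup>\<star> * y) - g (x\<^sup>\<star> * y))"
    by (metis norm_mult norm_numeral norm_triangle_ineq4)
  also have "\<dots> \<le> sqrt (p x * p y) + sqrt (n x * n y)"
    using positive_functional_Cauchy_Schwarz[OF P, of x y]
      positive_functional_Cauchy_Schwarz[OF N, of x y]
    by (intro add_mono real_le_rsqrt) (simp_all add: p_def n_def)
  finally have "(2 * cmod (g (x\<^sup>\<star> * y)))\<^sup>2 \<le> (sqrt (p x) * sqrt (p y) + sqrt (n x) * sqrt (n y))\<^sup>2"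
    by (intro power_mono) (simp_all add: real_sqrt_mult)
  also have "\<dots> \<le> ((sqrt (p x))\<^sup>2 + (sqrt (n x))\<^sup>2) * ((sqrt (p y))\<^sup>2 + (sqrt (n y))\<^sup>2)"
  proof -
    have "(A * B + D * E)\<^sup>2 + (A * E - D * B)\<^sup>2 = (A\<^sup>2 + D\<^sup>2) * (B\<^sup>2 + E\<^sup>2)" for A B D E :: real
      by (simp add: power2_eq_square algebra_simps)
    then show ?thesis by (metis le_add_same_cancel1 zero_le_power2)
  qed
  also have "\<dots> = (2 * \<alpha> * Re (f (x\<^sup>\<star> * x))) * (2 * \<alpha> * Re (f (y\<^sup>\<star> * y)))"
    using nonneg by (simp add: sum)
  finally show "(cmod (g (x\<^sup>\<star> * y)))\<^sup>2 \<le> \<alpha>\<^sup>2 * Re (f (x\<^sup>\<star> * x)) * Re (f (y\<^sup>\<star> * y))"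
    by (simp add: power2_eq_square algebra_simps)
qed

lemma hermitian_symmetric_on: "hermitian g \<Longrightarrow> symmetric_on I g"
  unfolding hermitian_def symmetric_on_def by (metis star_mult star_star)

text \<open>
  Positivity of \<open>\<alpha> f \<plusminus> g\<close> bounds the \<open>f\<close>-bound of \<open>g\<close> by \<open>\<alpha>\<close> from above. It is bounded by \<open>\<alpha>\<close> from
  below because every bounding constant of \<open>g\<close> is also one of its restriction \<open>g\<^sub>0\<close>.
\<close>

lemma bound_preserving_iff:
  fixes I :: "'a::complex_star_algebra set"
  assumes I: "left_ideal I" and f: "positive_functional f" and g0: "f_bounded f I g0"
    and \<alpha>: "\<alpha> = f_bound f I g0" and g: "g \<in> dual" "extends I g0 g"
  shows "hermitian g \<and> f_bounded f UNIV g \<and> f_bound f UNIV g = \<alpha> \<longleftrightarrow>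
    positive_functional (\<lambda>x. of_real \<alpha> * f x + g x) \<and>
    positive_functional (\<lambda>x. of_real \<alpha> * f x - g x)" (is "?L \<longleftrightarrow> ?P \<and> ?N")
proof
  assume L: ?L
  have lin: "linear_functional_on UNIV g" using g by (simp add: linear_functional_on_UNIV)
  have b: "bounding_constant f UNIV g \<alpha>" "0 \<le> \<alpha>"
    using L f_bound_least[of f UNIV g] by auto
  have "symmetric_on UNIV g" using L by (simp add: hermitian_symmetric_on)
  note pos = bounding_constant_imp_positive[OF f lin this b, unfolded positive_on_UNIV]
  show "?P \<and> ?N" using pos[of 1] pos[of "- 1"] by simp
next
  assume R: "?P \<and> ?N"
  then have b: "bounding_constant f UNIV g \<alpha>"
    by (simp add: positive_imp_bounding_constant)
  then have bounded: "f_bounded f UNIV g" by (auto simp: f_bounded_def)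
  have "bounding_constant f I g0 (f_bound f UNIV g)"
    using f_bound_least(2)[OF bounded] g(2) left_idealD(5)[OF I]
    unfolding bounding_constant_def extends_def by (metis UNIV_I)
  then have "\<alpha> \<le> f_bound f UNIV g"
    using f_bound_least(3)[OF g0] f_bound_least(1)[OF bounded] \<alpha> by simp
  moreover have "f_bound f UNIV g \<le> \<alpha>"
    using f_bound_least(3)[OF bounded] b f_bound_least(1)[OF g0] \<alpha> by simp
  moreover have "hermitian g"
    using positive_functional_hermitian[of "\<lambda>x. of_real \<alpha> * f x + g x"]
      positive_functional_hermitian[OF f] R
    by (simp add: hermitian_def)
  ultimately show ?L using bounded by simp
qed

lemma positive_functional_add:
  assumes "positive_functional p" "positive_functional q"
  shows "positive_functional (\<lambda>x. p x + q x)"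
  using assms dual_combination[of p q 1 1] by (simp add: positive_functional_def)

lemma positive_functional_eq_0_on_ideal:
  assumes "left_ideal I" "positive_functional p" "\<And>a. a \<in> I \<Longrightarrow> p (a\<^sup>\<star> * a) = 0" "a \<in> I"
  shows "p a = 0"
  using positive_functional_Cauchy_Schwarz[OF assms(2), of 1 a] assms(3,4) by simp

text \<open>
  On squares of \<open>I\<close> the positive functional \<open>g - k\<close> is squeezed between \<open>0\<close> and \<open>l - k = 0\<close>, and a
  positive functional that vanishes on the squares of \<open>I\<close> vanishes on \<open>I\<close>.
\<close>

lemma extends_between:
  assumes I: "left_ideal I" and k: "extends I g0 k" and l: "extends I g0 l"
    and le: "k \<preceq> g" "g \<preceq> l"
  shows "extends I g0 g"
  unfolding extends_def
proof
  fix a assume a: "a \<in> I"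
  have "g b - k b = 0" if b: "b \<in> I" for b
  proof (rule positive_functional_eq_0_on_ideal[OF I _ _ b])
    show "positive_functional (\<lambda>x. g x - k x)"
      using le(1) by (simp add: functional_le_def)
    fix c assume c: "c \<in> I"
    have "l (c\<^sup>\<star> * c) = k (c\<^sup>\<star> * c)"
      using k l c left_idealD(5)[OF I] by (simp add: extends_def)
    moreover have "0 \<le> g (c\<^sup>\<star> * c) - k (c\<^sup>\<star> * c)" "0 \<le> l (c\<^sup>\<star> * c) - g (c\<^sup>\<star> * c)"
      using le by (auto simp: functional_le_def positive_functional_def)
    ultimately show "g (c\<^sup>\<star> * c) - k (c\<^sup>\<star> * c) = 0"
      by (auto simp: less_eq_complex_def complex_eq_iff)
  qed
  then show "g a = g0 a" using a k by (simp add: extends_def)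
qed

theorem theorem4p1:
  fixes I :: "'a::complex_star_algebra set" and f g0 :: "'a \<Rightarrow> complex"
  assumes "left_ideal I"
    and "representable f"
    and "linear_functional_on I g0"
    and "symmetric_on I g0"
    and "f_bounded f I g0"
  shows "\<exists>gm gM.
    gm \<in> dual \<and> hermitian gm \<and> extends I g0 gm \<and>
    f_bounded f UNIV gm \<and> f_bound f UNIV gm = f_bound f I g0 \<and>
    gM \<in> dual \<and> hermitian gM \<and> extends I g0 gM \<and>
    f_bounded f UNIV gM \<and> f_bound f UNIV gM = f_bound f I g0 \<and>
    gm \<preceq> gM \<and>
    functional_interval gm gM =
      {g \<in> dual. extends I g0 g \<and> hermitian g \<and>
         f_bounded f UNIV g \<and> f_bound f UNIV g = f_bound f I g0}"
proof -
  define \<alpha> where "\<alpha> = f_bound f I g0"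
  have b: "bounding_constant f I g0 \<alpha>" "0 \<le> \<alpha>"
    using f_bound_least[OF assms(5)] by (auto simp: \<alpha>_def)
  have f: "positive_functional f" using assms(2) by (simp add: representable_def)
  then have f_dual: "f \<in> dual" by (simp add: positive_functional_def)
  define h where "h s = (\<lambda>x. of_real \<alpha> * f x + of_real s * g0 x)" for s :: real
  have ex: "\<exists>k. positive_functional k \<and> extends I (h s) k \<and>
      k \<preceq> (\<lambda>x. of_real (2 * \<alpha>) * f x) \<and>
      (\<forall>r. positive_functional r \<longrightarrow> extends I (h s) r \<longrightarrow> k \<preceq> r)" if s: "s = 1 \<or> s = - 1" for s
  proof -
    have "positive_on I (h s)"
      unfolding h_def by (rule bounding_constant_imp_positive[OF f assms(3,4) b s])
    moreover have "0 \<le> 2 * \<alpha>" using b by simp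
    moreover have "(cmod (h s (x\<^sup>\<star> * a)))\<^sup>2 \<le> (2 * \<alpha>) * Re (f (x\<^sup>\<star> * x)) * Re (h s (a\<^sup>\<star> * a))"
      if "a \<in> I" for x a
      using bounding_constant_imp_dominated[OF f assms(1,3) b s h_def that] .
    ultimately show ?thesis
      using minimal_positive_extension[OF assms(1,2), of "h s" "2 * \<alpha>"] by metis
  qed
  obtain p where p: "positive_functional p" "extends I (h 1) p"
      "p \<preceq> (\<lambda>x. of_real (2 * \<alpha>) * f x)"
      "\<And>r. positive_functional r \<Longrightarrow> extends I (h 1) r \<Longrightarrow> p \<preceq> r"
    using ex[of 1] by auto
  obtain n where n: "positive_functional n" "extends I (h (- 1)) n"
      "n \<preceq> (\<lambda>x. of_real (2 * \<alpha>) * f x)"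
      "\<And>r. positive_functional r \<Longrightarrow> extends I (h (- 1)) r \<Longrightarrow> n \<preceq> r"
    using ex[of "- 1"] by auto
  have dual: "p \<in> dual" "n \<in> dual" using p(1) n(1) by (auto simp: positive_functional_def)
  define gm where "gm = (\<lambda>x. p x - of_real \<alpha> * f x)"
  define gM where "gM = (\<lambda>x. of_real \<alpha> * f x - n x)"
  have gm_dual: "gm \<in> dual"
    using dual_combination[OF dual(1) f_dual, of 1 "- of_real \<alpha>"] by (simp add: gm_def)
  have gM_dual: "gM \<in> dual"
    using dual_combination[OF dual(2) f_dual, of "- 1" "of_real \<alpha>"] by (simp add: gM_def)
  have gm_ext: "extends I g0 gm" using p(2) by (simp add: extends_def h_def gm_def)
  have gM_ext: "extends I g0 gM" using n(2) by (simp add: extends_def h_def gM_def)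
  note iff = bound_preserving_iff[OF assms(1) f assms(5) \<alpha>_def]
  have gm_pos: "positive_functional (\<lambda>x. of_real \<alpha> * f x + gm x)"
    "positive_functional (\<lambda>x. of_real \<alpha> * f x - gm x)"
    using p(1,3) by (simp_all add: gm_def functional_le_def algebra_simps)
  have gM_pos: "positive_functional (\<lambda>x. of_real \<alpha> * f x + gM x)"
    "positive_functional (\<lambda>x. of_real \<alpha> * f x - gM x)"
    using n(1,3) by (simp_all add: gM_def functional_le_def algebra_simps)
  \<comment> \<open>Minimality of \<open>p\<close> gives the lower end, minimality of \<open>n\<close> the upper end.\<close>
  have gm_le: "gm \<preceq> g" and le_gM: "g \<preceq> gM"
    if "extends I g0 g" "positive_functional (\<lambda>x. of_real \<alpha> * f x + g x)"
      "positive_functional (\<lambda>x. of_real \<alpha> * f x - g x)" for g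
    using p(4)[OF that(2)] n(4)[OF that(3)] that(1)
    by (simp_all add: extends_def h_def functional_le_def gm_def gM_def algebra_simps)
  have "functional_interval gm gM =
      {g \<in> dual. extends I g0 g \<and> hermitian g \<and> f_bounded f UNIV g \<and> f_bound f UNIV g = \<alpha>}"
  proof (intro equalityI subsetI)
    fix g assume "g \<in> functional_interval gm gM"
    then have g: "g \<in> dual" "gm \<preceq> g" "g \<preceq> gM" by (auto simp: functional_interval_def)
    have "extends I g0 g" using extends_between[OF assms(1) gm_ext gM_ext g(2,3)] .
    moreover have "positive_functional (\<lambda>x. of_real \<alpha> * f x + g x)"
      using positive_functional_add[OF gm_pos(1) g(2)[unfolded functional_le_def]] by simp
    moreover have "positive_functional (\<lambda>x. of_real \<alpha> * f x - g x)"
      using positive_functional_add[OF gM_pos(2) g(3)[unfolded functional_le_def]] by simp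
    ultimately show "g \<in> {g \<in> dual. extends I g0 g \<and> hermitian g \<and>
        f_bounded f UNIV g \<and> f_bound f UNIV g = \<alpha>}"
      using g(1) iff by blast
  next
    fix g assume "g \<in> {g \<in> dual. extends I g0 g \<and> hermitian g \<and>
        f_bounded f UNIV g \<and> f_bound f UNIV g = \<alpha>}"
    then show "g \<in> functional_interval gm gM"
      using iff gm_le le_gM unfolding functional_interval_def by blast
  qed
  then show ?thesis
    using gm_dual gM_dual gm_ext gM_ext iff[OF gm_dual gm_ext] iff[OF gM_dual gM_ext] gm_pos gM_pos
      gm_le[OF gM_ext gM_pos]
    unfolding \<alpha>_def[symmetric] by blast
qed

end
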